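(* Let $\mathbf{N}_{12}$ be the $2$-dimensional complex algebra with basis $e_1,e_2$ and multiplication $e_1e_1=e_1$, $e_1e_2=-e_1$, $e_2e_1=-e_2$, $e_2e_2=e_2$. Then $\mathbf{N}_{12}$ is a complex simple finite-dimensional non-commutative anti-Novikov algebra, and it does not embed (as a subalgebra) in any algebra of the form $\mathcal{A}_\varphi$, where $\mathcal{A}$ is a commutative associative algebra, $\varphi$ is a $\delta$-derivation of $\mathcal{A}$ for some $\delta\in\mathbb{C}$, and $\mathcal{A}_\varphi$ is the vector space $\mathcal{A}$ with multiplication $x\circ y=x\varphi(y)$.
   Context: Algebras are not necessarily associative, over $\mathbb{C}$. For $\delta\in\mathbb{C}$, a (left) $\delta$-Novikov algebra is an algebra satisfying $\delta(xy)z-x(yz)=\delta(yx)z-y(xz)$ and $(xy)z=(xz)y$ for all $x,y,z$; an anti-Novikov algebra is a $\delta$-Novikov algebra with $\delta=-1$. A $\delta$-derivation of an algebra $\mathcal{A}$ is a linear map $\varphi:\mathcal{A}\to\mathcal{A}$ with $\varphi(xy)=\delta(\varphi(x)y+x\varphi(y))$ for all $x,y$. If $\mathcal{A}$ is commutative associative and $\varphi$ is a $\delta$-derivation, then $\mathcal{A}_\varphi$ is a $\delta$-Novikov algebra. *)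

theory Defs
  imports "HOL-Analysis.Analysis"
begin

text \<open>
  The library's notion of algebra is associative, so the nonassociative ones are set up here: complex
  vector spaces (carrier: a whole type, explicit scalar multiplication) with a bilinear product.
  No unit element is required anywhere, in particular not in the commutative associative case.
\<close>

locale nonassoc_algebra = vector_space smul
  for smul :: "complex \<Rightarrow> 'a::ab_group_add \<Rightarrow> 'a" +
  fixes mul :: "'a \<Rightarrow> 'a \<Rightarrow> 'a"
  assumes linear_left: "Vector_Spaces.linear smul smul (\<lambda>x. mul x y)"
    and linear_right: "Vector_Spaces.linear smul smul (\<lambda>y. mul x y)"

locale delta_novikov_algebra = nonassoc_algebra smul mul
  for \<delta> :: complex
    and smul :: "complex \<Rightarrow> 'a::ab_group_add \<Rightarrow> 'a"
    and mul :: "'a \<Rightarrow> 'a \<Rightarrow> 'a" +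
  assumes left_identity:
      "smul \<delta> (mul (mul x y) z) - mul x (mul y z) =
       smul \<delta> (mul (mul y x) z) - mul y (mul x z)"
    and right_commute: "mul (mul x y) z = mul (mul x z) y"

abbreviation anti_novikov_algebra ::
    "(complex \<Rightarrow> 'a::ab_group_add \<Rightarrow> 'a) \<Rightarrow> ('a \<Rightarrow> 'a \<Rightarrow> 'a) \<Rightarrow> bool" where
  "anti_novikov_algebra \<equiv> delta_novikov_algebra (- 1)"

definition commutative_mult :: "('a \<Rightarrow> 'a \<Rightarrow> 'a) \<Rightarrow> bool" where
  "commutative_mult mul \<longleftrightarrow> (\<forall>x y. mul x y = mul y x)"

locale comm_assoc_algebra = nonassoc_algebra +
  assumes commutative: "commutative_mult mul"
    and associative: "mul (mul x y) z = mul x (mul y z)"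

definition two_sided_ideal ::
    "(complex \<Rightarrow> 'a::ab_group_add \<Rightarrow> 'a) \<Rightarrow> ('a \<Rightarrow> 'a \<Rightarrow> 'a) \<Rightarrow> 'a set \<Rightarrow> bool" where
  "two_sided_ideal smul mul I \<longleftrightarrow>
     module.subspace smul I \<and> (\<forall>x\<in>I. \<forall>a. mul a x \<in> I \<and> mul x a \<in> I)"

definition simple_algebra ::
    "(complex \<Rightarrow> 'a::ab_group_add \<Rightarrow> 'a) \<Rightarrow> ('a \<Rightarrow> 'a \<Rightarrow> 'a) \<Rightarrow> bool" where
  "simple_algebra smul mul \<longleftrightarrow>
     nonassoc_algebra smul mul \<and> (\<exists>x y. mul x y \<noteq> 0) \<and>
     (\<forall>I. two_sided_ideal smul mul I \<longrightarrow> I = {0} \<or> I = UNIV)"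

definition delta_derivation ::
    "(complex \<Rightarrow> 'a::ab_group_add \<Rightarrow> 'a) \<Rightarrow> ('a \<Rightarrow> 'a \<Rightarrow> 'a) \<Rightarrow> complex \<Rightarrow> ('a \<Rightarrow> 'a) \<Rightarrow> bool" where
  "delta_derivation smul mul \<delta> \<phi> \<longleftrightarrow>
     Vector_Spaces.linear smul smul \<phi> \<and>
     (\<forall>x y. \<phi> (mul x y) = smul \<delta> (mul (\<phi> x) y + mul x (\<phi> y)))"

definition derived_mult :: "('a \<Rightarrow> 'a \<Rightarrow> 'a) \<Rightarrow> ('a \<Rightarrow> 'a) \<Rightarrow> 'a \<Rightarrow> 'a \<Rightarrow> 'a" where
  "derived_mult mul \<phi> x y = mul x (\<phi> y)"

definition algebra_embeds ::
    "(complex \<Rightarrow> 'a::ab_group_add \<Rightarrow> 'a) \<Rightarrow> ('a \<Rightarrow> 'a \<Rightarrow> 'a) \<Rightarrow>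
     (complex \<Rightarrow> 'b::ab_group_add \<Rightarrow> 'b) \<Rightarrow> ('b \<Rightarrow> 'b \<Rightarrow> 'b) \<Rightarrow> bool" where
  "algebra_embeds smul1 mul1 smul2 mul2 \<longleftrightarrow>
     (\<exists>f. Vector_Spaces.linear smul1 smul2 f \<and> inj f \<and>
          (\<forall>x y. f (mul1 x y) = mul2 (f x) (f y)))"

definition N12_basis_mult :: "2 \<Rightarrow> 2 \<Rightarrow> complex ^ 2" where
  "N12_basis_mult i j = (if i = j then axis i 1 else - axis i 1)"

definition N12_mult :: "complex ^ 2 \<Rightarrow> complex ^ 2 \<Rightarrow> complex ^ 2" where
  "N12_mult x y = (\<Sum>i\<in>UNIV. \<Sum>j\<in>UNIV. (x $ i * y $ j) *s N12_basis_mult i j)"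

lemma N12_mult_axis: "N12_mult (axis i 1) (axis j 1) = N12_basis_mult i j"
  using exhaust_2[of i] exhaust_2[of j]
  by (auto simp: N12_mult_def N12_basis_mult_def sum_2 axis_def vec_eq_iff)

text \<open>The multiplication table, with \<open>e\<^sub>1 = axis 1 1\<close> and \<open>e\<^sub>2 = axis 2 1\<close>.\<close>

lemma N12_table:
  "N12_mult (axis 1 1) (axis 1 1) = axis 1 1"
  "N12_mult (axis 1 1) (axis 2 1) = - axis 1 1"
  "N12_mult (axis 2 1) (axis 1 1) = - axis 2 1"
  "N12_mult (axis 2 1) (axis 2 1) = axis 2 1"
  by (simp_all add: N12_mult_axis N12_basis_mult_def)

end

theory Submission
  imports Defs
begin

text \<open>
  The product of \<open>N\<^sub>1\<^sub>2\<close> is \<open>x \<cdot> y = \<ell>(y) \<sigma>(x)\<close> with the functional \<open>\<ell>(y) = y\<^sub>1 - y\<^sub>2\<close> and the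
  involution \<open>\<sigma>(x) = (x\<^sub>1, - x\<^sub>2)\<close>. Hence right multiplications commute, and the anti-Novikov
  identity reduces to the symmetry of \<open>\<ell>(y) x + \<ell>(\<sigma>(y)) \<sigma>(x) = 2 (x\<^sub>1 y\<^sub>1, - x\<^sub>2 y\<^sub>2)\<close> in \<open>x\<close> and \<open>y\<close>.
  The algebra is simple because left multiples of an element outside the kernel of \<open>\<ell>\<close> fill the whole
  plane, while a nonzero element of the kernel leaves it after one right multiplication.

  For the non-embedding, suppose that \<open>a\<close> and \<open>b\<close> are the images of \<open>e\<^sub>1\<close> and \<open>e\<^sub>2\<close>. Moving \<open>\<phi>(a)\<close> through
  the product \<open>a b\<close> by commutativity and associativity gives \<open>a b = - a b\<close>, so \<open>a b = 0\<close>. Applying the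
  \<open>\<delta>\<close>-derivation \<open>\<phi>\<close> to this turns it into \<open>\<delta> (a + b) = 0\<close>. If \<open>\<delta> = 0\<close>, then \<open>\<phi>\<close> kills all products,
  in particular \<open>a = a \<phi>(a)\<close>; so \<open>\<phi>(a) = 0\<close>, and \<open>a = a \<phi>(a)\<close> and \<open>b = - b \<phi>(a)\<close> vanish. In either case \<open>a + b = 0\<close>, although
  \<open>e\<^sub>1 + e\<^sub>2 \<noteq> 0\<close>.
\<close>

lemma N12_mult_nth:
  "N12_mult x y $ 1 = x $ 1 * (y $ 1 - y $ 2)"
  "N12_mult x y $ 2 = - (x $ 2 * (y $ 1 - y $ 2))"
  by (simp_all add: N12_mult_def N12_basis_mult_def sum_2 axis_def algebra_simps)

lemma N12_nonassoc_algebra: "nonassoc_algebra (*s) N12_mult"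
  by unfold_locales (simp_all add: vec_eq_iff forall_2 N12_mult_nth algebra_simps)

lemma N12_anti_novikov: "anti_novikov_algebra (*s) N12_mult"
proof -
  interpret nonassoc_algebra "(*s)" N12_mult
    by (rule N12_nonassoc_algebra)
  show ?thesis
    by unfold_locales (simp_all add: vec_eq_iff forall_2 N12_mult_nth algebra_simps)
qed

text \<open>
  The equation \<open>a \<cdot> x = \<ell>(x) \<sigma>(a)\<close> can be solved for \<open>a\<close> with any right-hand side once \<open>\<ell>(x) \<noteq> 0\<close>.
\<close>

lemma N12_ideal_eq_UNIV:
  assumes "two_sided_ideal (*s) N12_mult I" and "x \<in> I" and "x $ 1 \<noteq> x $ 2"
  shows "I = UNIV"
proof (rule UNIV_eq_I[symmetric])
  fix z :: "complex ^ 2"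
  define a :: "complex ^ 2"
    where "a = (\<chi> i. if i = 1 then z $ 1 / (x $ 1 - x $ 2) else - z $ 2 / (x $ 1 - x $ 2))"
  have "N12_mult a x = z"
    using assms(3) by (simp add: vec_eq_iff forall_2 N12_mult_nth a_def)
  moreover have "N12_mult a x \<in> I"
    using assms(1,2) by (auto simp: two_sided_ideal_def)
  ultimately show "z \<in> I"
    by simp
qed

lemma N12_simple: "simple_algebra (*s) N12_mult"
proof -
  have "N12_mult (axis 1 1) (axis 1 1) \<noteq> 0"
    by (simp add: N12_table)
  moreover have "I = {0} \<or> I = UNIV" if I: "two_sided_ideal (*s) N12_mult I" for I
  proof (cases "\<exists>x\<in>I. x \<noteq> 0")
    case True
    then obtain x where x: "x \<in> I" "x \<noteq> 0"
      by blast
    show ?thesis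
    proof (cases "x $ 1 = x $ 2")
      case True
      \<comment> \<open>Here \<open>x = (t, t)\<close> with \<open>t \<noteq> 0\<close>, and multiplying by \<open>e\<^sub>1\<close> gives \<open>(t, - t)\<close>.\<close>
      let ?y = "N12_mult x (axis 1 1)"
      have "?y \<in> I"
        using I x by (auto simp: two_sided_ideal_def)
      moreover have "?y $ 1 \<noteq> ?y $ 2"
        using True x(2) by (auto simp: N12_mult_nth axis_def vec_eq_iff forall_2)
      ultimately show ?thesis
        using N12_ideal_eq_UNIV[OF I] by blast
    qed (use N12_ideal_eq_UNIV[OF I] x in blast)
  next
    case False
    have "0 \<in> I"
      using I vec.subspace_0 by (auto simp: two_sided_ideal_def)
    with False show ?thesis
      by blast
  qed
  ultimately show ?thesis
    unfolding simple_algebra_def using N12_nonassoc_algebra by blast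
qed

text \<open>
  The hypotheses are three entries of the multiplication table of \<open>N\<^sub>1\<^sub>2\<close>, read in \<open>\<A>\<^sub>\<phi>\<close>.
  Commutativity and associativity turn them into \<open>a b = 0\<close>, which the derivation rule transports to
  \<open>a + b\<close>.
\<close>

lemma (in comm_assoc_algebra) delta_derivation_table_sum_eq_0:
  assumes der: "delta_derivation smul mul \<delta> \<phi>"
    and aa: "mul a (\<phi> a) = a" and ab: "mul a (\<phi> b) = - a" and ba: "mul b (\<phi> a) = - b"
  shows "a + b = 0"
proof -
  have comm: "mul x y = mul y x" for x y
    using commutative by (simp add: commutative_mult_def)
  interpret right: Vector_Spaces.linear smul smul "mul x" for x
    by (rule linear_right)
  interpret \<phi>: Vector_Spaces.linear smul smul \<phi>
    using der by (simp add: delta_derivation_def)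
  have rule: "\<phi> (mul x y) = smul \<delta> (mul (\<phi> x) y + mul x (\<phi> y))" for x y
    using der by (simp add: delta_derivation_def)
  have "mul a b = mul (mul a (\<phi> a)) b"
    by (simp add: aa)
  also have "\<dots> = mul a (mul b (\<phi> a))"
    by (simp add: associative comm[of b])
  also have "\<dots> = - mul a b"
    by (simp add: ba right.neg)
  finally have "smul 2 (mul a b) = 0"
    using scale_left_distrib[of 1 1 "mul a b"] by (simp add: eq_neg_iff_add_eq_0)
  then have "mul a b = 0"
    by simp
  then have "smul \<delta> (mul (\<phi> a) b + mul a (\<phi> b)) = 0"
    using rule[of a b] \<phi>.zero by simp
  then have "smul \<delta> (- (a + b)) = 0"
    by (simp add: comm[of "\<phi> a"] ab ba add.commute)
  then consider "\<delta> = 0" | "a + b = 0"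
    by (metis scale_eq_0_iff neg_equal_0_iff_equal)
  then show ?thesis
  proof cases
    case 1
    have "\<phi> a = 0"
      using rule[of a "\<phi> a"] aa 1 by simp
    then show ?thesis
      using aa ba by simp
  qed
qed

lemma N12_not_embeds_derived_mult:
  assumes "comm_assoc_algebra smul mul" and "delta_derivation smul mul \<delta> \<phi>"
  shows "\<not> algebra_embeds (*s) N12_mult smul (derived_mult mul \<phi>)"
proof
  assume "algebra_embeds (*s) N12_mult smul (derived_mult mul \<phi>)"
  then obtain f where lin: "Vector_Spaces.linear (*s) smul f" and inj: "inj f"
    and hom: "\<And>x y. f (N12_mult x y) = mul (f x) (\<phi> (f y))"
    by (auto simp: algebra_embeds_def derived_mult_def)
  interpret f: Vector_Spaces.linear "(*s)" smul f
    by (rule lin)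
  let ?e1 = "axis 1 1 :: complex ^ 2" and ?e2 = "axis 2 1 :: complex ^ 2"
  have "f ?e1 + f ?e2 = 0"
    using comm_assoc_algebra.delta_derivation_table_sum_eq_0[OF assms, of "f ?e1" "f ?e2"]
    by (simp add: hom[symmetric] N12_table f.neg)
  then have "f (?e1 + ?e2) = f 0"
    by (simp add: f.add)
  then have "?e1 + ?e2 = 0"
    by (rule injD[OF inj])
  then show False
    by (simp add: vec_eq_iff forall_2 axis_def)
qed

theorem proposition12:
  "anti_novikov_algebra (*s) N12_mult \<and>
   simple_algebra (*s) N12_mult \<and>
   (\<exists>B. finite_dimensional_vector_space ((*s) :: complex \<Rightarrow> complex ^ 2 \<Rightarrow> complex ^ 2) B) \<and>
   \<not> commutative_mult N12_mult \<and>
   (\<forall>(smul :: complex \<Rightarrow> 'b::ab_group_add \<Rightarrow> 'b) mul \<delta> \<phi>.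
      comm_assoc_algebra smul mul \<and> delta_derivation smul mul \<delta> \<phi> \<longrightarrow>
      \<not> algebra_embeds (*s) N12_mult smul (derived_mult mul \<phi>))"
proof (intro conjI allI impI)
  show "\<exists>B. finite_dimensional_vector_space ((*s) :: complex \<Rightarrow> complex ^ 2 \<Rightarrow> complex ^ 2) B"
    using vec.finite_dimensional_vector_space_axioms by blast
  have "N12_mult (axis 1 1) (axis 2 1) $ 1 \<noteq> N12_mult (axis 2 1) (axis 1 1) $ 1"
    by (simp add: N12_mult_nth axis_def)
  then show "\<not> commutative_mult N12_mult"
    unfolding commutative_mult_def by metis
qed (use N12_anti_novikov N12_simple N12_not_embeds_derived_mult in blast)+

end
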